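(* For every integer $n\ge 0$, the polynomial $y=H_n(x)$ satisfies the differential equation $$ x(x-2)\,\frac{d^2y}{dx^2} + (2x-1)\,\frac{dy}{dx} - n(n+1)\,y = 0. $$
   Context: For $k\ge 0$ let $a_k(x)=\sum_{m=0}^{k}\binom{2k+1-m}{k-m}x^m$, and for $n\ge 0$ let $H_n(x)=\det[a_{i+j}(x)]_{0\le i,j\le n}$ be the $(n+1)\times(n+1)$ Hankel determinant. *)

theory Defs
  imports
    "HOL-Computational_Algebra.Polynomial"
    "Jordan_Normal_Form.Determinant"
begin

definition hankel_entry :: "nat \<Rightarrow> real poly" where
  "hankel_entry k = (\<Sum>m=0..k. monom (of_nat ((2 * k + 1 - m) choose (k - m))) m)"

definition hankel_det :: "nat \<Rightarrow> real poly" where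
  "hankel_det n = det (mat (n + 1) (n + 1) (\<lambda>(i, j). hankel_entry (i + j)))"

end

theory Submission
  imports Defs
begin

text \<open>
  Put \<open>q = x - 1\<close>.  Reading \<open>a\<^sub>k\<close> as the coefficient of \<open>u\<^sup>k\<close> in
  \<open>(1 + u)\<^bsup>2k+2\<^esup> / (1 - q u)\<close> exhibits \<open>a\<^sub>k\<close> as the \<open>k\<close>-th moment
  (the constant term of \<open>z\<^sup>k g(u)\<close>, where \<open>z = u + 2 + 1/u\<close> and \<open>g(u) = (1 + u)\<^sup>2 / (1 - q u)\<close>)
  of a Chebyshev-like functional.  In a suitable basis of monic polynomials in \<open>z\<close> the
  Gram matrix of this functional is the tridiagonal matrix \<open>T\<close> with off-diagonal
  entries \<open>1\<close> and diagonal \<open>1, -2q, -2q, \<dots>\<close>.  Let \<open>K\<close> be the unitriangular matrix that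
  expands the powers of \<open>z\<close> in that basis.  The Hankel matrix is then \<open>K T K\<^sup>t\<close>
  (lemma \<open>hankel_factorization\<close>).  The factorization is proved without
  reference to the functional: multiplication by \<open>z\<close> acts on the rows of \<open>K\<close> by a
  tridiagonal matrix \<open>J\<close> for which \<open>J T\<close> is symmetric, so the \<open>(i, j)\<close> entry of
  \<open>K T K\<^sup>t\<close> depends only on \<open>i + j\<close>, and its row \<open>0\<close> is \<open>a\<^sub>0, a\<^sub>1, \<dots>\<close>.

  Hence \<open>H\<^sub>n = det T\<close>, which up to sign is the solution of the Chebyshev recurrence
  \<open>V\<^sub>0 = 1\<close>, \<open>V\<^sub>1 = -1\<close>, \<open>V\<^bsub>n+2\<^esub> = 2q V\<^bsub>n+1\<^esub> - V\<^sub>n\<close> at index \<open>n + 1\<close> (lemma \<open>det_tridiag\<close>);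
  with \<open>q = cos \<theta>\<close>, one has \<open>V\<^bsub>n+1\<^esub> = - sin((n + 1/2) \<theta>) / sin(\<theta>/2)\<close>.  For this Jacobi
  polynomial a first-order relation (lemma \<open>chebyshev_pderiv\<close>) and the differential
  equation (lemma \<open>chebyshev_ode\<close>) follow from the recurrence by induction.
\<close>

section \<open>The moments as coefficients of a rational generating function\<close>

text \<open>The coefficient of \<open>u\<^sup>k\<close> in \<open>(1 + u)\<^sup>N / (1 - q u)\<close>.\<close>

definition binom_geom :: "'a::comm_ring_1 \<Rightarrow> nat \<Rightarrow> nat \<Rightarrow> 'a" where
  "binom_geom q N k = (\<Sum>m\<le>k. of_nat (N choose (k - m)) * q ^ m)"

lemma binom_geom_0 [simp]: "binom_geom q N 0 = 1"
  by (simp add: binom_geom_def)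

lemma binom_geom_geometric:
  "binom_geom q N (Suc k) = of_nat (N choose Suc k) + q * binom_geom q N k"
  unfolding binom_geom_def
  by (subst sum.atMost_Suc_shift) (simp add: sum_distrib_left algebra_simps)

lemma binom_geom_pascal:
  "binom_geom q (Suc N) (Suc k) = binom_geom q N (Suc k) + binom_geom q N k"
proof (induction k)
  case 0
  show ?case by (simp add: binom_geom_geometric)
next
  case (Suc k)
  have "binom_geom q (Suc N) (Suc (Suc k))
      = of_nat (Suc N choose Suc (Suc k)) + q * (binom_geom q N (Suc k) + binom_geom q N k)"
    using Suc by (simp add: binom_geom_geometric[of q "Suc N" "Suc k"])
  also have "\<dots> = binom_geom q N (Suc (Suc k)) + binom_geom q N (Suc k)"
    by (simp add: binom_geom_geometric algebra_simps)
  finally show ?case .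
qed

text \<open>
  The substitution \<open>q = x - 1\<close> in \<open>(1 + u)\<^bsup>N+1\<^esup> / (1 - q u) = (1 + u)\<^sup>N / (1 - x u / (1 + u))\<close>,
  in coefficients.
\<close>

lemma sum_binomial_eq_binom_geom:
  fixes x :: "'a::comm_ring_1"
  assumes "k \<le> N"
  shows "(\<Sum>m\<le>k. of_nat ((N - m) choose (k - m)) * x ^ m) = binom_geom (x - 1) (Suc N) k"
  using assms
proof (induction k arbitrary: N)
  case 0
  show ?case by simp
next
  case (Suc k)
  then obtain M where N: "N = Suc M" and "k \<le> M"
    by (cases N) auto
  have "(\<Sum>m\<le>Suc k. of_nat ((N - m) choose (Suc k - m)) * x ^ m)
      = of_nat (N choose Suc k) + x * (\<Sum>m\<le>k. of_nat ((M - m) choose (k - m)) * x ^ m)"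
    by (subst sum.atMost_Suc_shift) (simp add: sum_distrib_left algebra_simps N)
  also have "\<dots> = of_nat (N choose Suc k) + x * binom_geom (x - 1) N k"
    using Suc.IH[OF \<open>k \<le> M\<close>] by (simp add: N)
  also have "\<dots> = binom_geom (x - 1) (Suc N) (Suc k)"
    by (simp add: binom_geom_pascal binom_geom_geometric[of _ N] algebra_simps)
  finally show ?case .
qed

lemma hankel_entry_eq_binom_geom:
  "hankel_entry k = binom_geom ([:0, 1:] - 1) (2 * k + 2) k"
proof -
  have "hankel_entry k = (\<Sum>m\<le>k. of_nat ((2 * k + 1 - m) choose (k - m)) * [:0, 1:] ^ m)"
    unfolding hankel_entry_def
    by (simp add: atMost_atLeast0 monom_altdef of_nat_poly)
  then show ?thesis
    using sum_binomial_eq_binom_geom[of k "2 * k + 1" "[:0, 1:] :: real poly"] by simp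
qed

section \<open>Factorization of the Hankel matrix\<close>

text \<open>
  The \<open>l\<close>-th coordinate of \<open>z\<^sup>i\<close>: entry \<open>(i, l)\<close> of the unitriangular matrix \<open>K\<close>.
\<close>

definition moment_coeff :: "'a::comm_ring_1 \<Rightarrow> nat \<Rightarrow> nat \<Rightarrow> 'a" where
  "moment_coeff q i l = (if l \<le> i then binom_geom q (2 * i + 1) (i - l) else 0)"

text \<open>
  The tridiagonal matrix \<open>T\<close>, and its action on sequences as an infinite matrix.
\<close>

definition tridiag :: "'a::comm_ring_1 \<Rightarrow> nat \<Rightarrow> nat \<Rightarrow> 'a" where
  "tridiag q i j =
    (if i = j then (if i = 0 then 1 else - 2 * q) else if i = Suc j \<or> j = Suc i then 1 else 0)"

definition tridiag_apply :: "'a::comm_ring_1 \<Rightarrow> (nat \<Rightarrow> 'a) \<Rightarrow> nat \<Rightarrow> 'a" where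
  "tridiag_apply q w l =
    (if l = 0 then w 0 + w 1 else w (l - 1) - 2 * q * w l + w (Suc l))"

lemma sum_tridiag:
  fixes q :: "'a::comm_ring_1"
  assumes "i \<le> n"
  shows "(\<Sum>j<Suc n. tridiag q i j * w j)
    = tridiag_apply q w i - (if i = n then w (Suc n) else 0)"
proof -
  have "tridiag q i j * w j = (if j = i then (if i = 0 then 1 else - 2 * q) * w i else 0)
      + (if j = Suc i then w (Suc i) else 0)
      + (if j = i - 1 then (if i = 0 then 0 else w (i - 1)) else 0)" for j
    by (auto simp: tridiag_def)
  then show ?thesis
    using assms by (auto simp: sum.distrib tridiag_apply_def)
qed

text \<open>
  Multiplication by \<open>z\<close>, as a tridiagonal matrix \<open>J\<close>, acting on coordinate rows
  (\<open>mult_row\<close>, the product \<open>v J\<close>) and on columns (\<open>mult_col\<close>, the product \<open>J w\<close>).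
\<close>

definition mult_row :: "'a::comm_ring_1 \<Rightarrow> (nat \<Rightarrow> 'a) \<Rightarrow> nat \<Rightarrow> 'a" where
  "mult_row q v l =
    (if l = 0 then (3 + q) * v 0 + (1 - q) * v 1 else v (l - 1) + 2 * v l + v (Suc l))"

definition mult_col :: "'a::comm_ring_1 \<Rightarrow> (nat \<Rightarrow> 'a) \<Rightarrow> nat \<Rightarrow> 'a" where
  "mult_col q w l =
    (if l = 0 then (3 + q) * w 0 + w 1
     else if l = 1 then (1 - q) * w 0 + 2 * w 1 + w 2
     else w (l - 1) + 2 * w l + w (Suc l))"

lemma moment_coeff_Suc: "moment_coeff q (Suc i) = mult_row q (moment_coeff q i)"
proof
  fix l
  have step: "binom_geom q (Suc (Suc N)) (Suc (Suc k))
      = binom_geom q N (Suc (Suc k)) + 2 * binom_geom q N (Suc k) + binom_geom q N k" for N k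
    by (simp add: binom_geom_pascal)
  have step1: "binom_geom q (Suc (Suc N)) (Suc 0) = binom_geom q N (Suc 0) + 2" for N
    by (simp add: binom_geom_pascal)
  show "moment_coeff q (Suc i) l = mult_row q (moment_coeff q i) l"
  proof (cases "l = 0")
    case True
    show ?thesis
    proof (cases i)
      case 0
      then show ?thesis
        using True by (simp add: moment_coeff_def mult_row_def step1 binom_geom_geometric)
    next
      case (Suc k)
      define N where "N = 2 * i + 1"
      \<comment> \<open>The reflection of the binomial coefficients about the middle produces the
          exceptional first column of \<open>J\<close>.\<close>
      have "N choose Suc i = N choose i"
        using binomial_symmetric[of i N] by (simp add: N_def)
      then have "binom_geom q N (Suc i) = of_nat (N choose Suc k) + q * binom_geom q N i"
        by (simp add: binom_geom_geometric Suc)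
      moreover have "binom_geom q N i = of_nat (N choose Suc k) + q * binom_geom q N k"
        by (simp add: binom_geom_geometric Suc)
      ultimately have "binom_geom q (Suc (Suc N)) (Suc i)
          = (3 + q) * binom_geom q N i + (1 - q) * binom_geom q N k"
        using step[of N k] by (simp add: Suc algebra_simps)
      then show ?thesis
        using True by (simp add: moment_coeff_def mult_row_def N_def Suc)
    qed
  next
    case False
    consider "l \<ge> i + 2" | "l = Suc i" | "l = i" | "l < i" by linarith
    then show ?thesis
    proof cases
      case 4
      then obtain k where "i = l + Suc k"
        using less_iff_Suc_add[of l i] by auto
      then show ?thesis
        using False step[of "2 * i + 1" k]
        by (auto simp: moment_coeff_def mult_row_def Suc_diff_le)
    qed (use False step1[of "2 * i + 1"] in \<open>auto simp: moment_coeff_def mult_row_def\<close>)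
  qed
qed

text \<open>Summation by parts, with the boundary term left by truncation.\<close>

lemma sum_mult_row:
  fixes q :: "'a::comm_ring_1"
  shows "(\<Sum>l<Suc (Suc n). mult_row q v l * w l)
    = (\<Sum>l<Suc (Suc n). v l * mult_col q w l)
      + v (Suc (Suc n)) * w (Suc n) - v (Suc n) * w (Suc (Suc n))"
proof (induction n)
  case 0
  show ?case by (simp add: mult_row_def mult_col_def numeral_2_eq_2 algebra_simps)
next
  case (Suc n)
  then show ?case
    by (subst (1 2) sum.lessThan_Suc) (simp add: mult_row_def mult_col_def algebra_simps)
qed

text \<open>The matrix \<open>J T\<close> is symmetric: \<open>J T = T J\<^sup>t\<close>.\<close>

lemma mult_col_tridiag_apply:
  "mult_col q (tridiag_apply q v) = tridiag_apply q (mult_row q v)"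
proof
  fix l
  consider "l = 0" | "l = 1" | "l = 2" | k where "l = Suc (Suc (Suc k))"
    by (metis One_nat_def Suc_1 not0_implies_Suc)
  then show "mult_col q (tridiag_apply q v) l = tridiag_apply q (mult_row q v) l"
    by cases (simp_all add: mult_col_def tridiag_apply_def mult_row_def numeral_2_eq_2 algebra_simps)
qed

lemma moment_coeff_product:
  fixes q :: "'a::comm_ring_1"
  shows "i \<le> n \<Longrightarrow> (\<Sum>l<Suc n. moment_coeff q i l * tridiag_apply q (moment_coeff q j) l)
    = binom_geom q (2 * (i + j) + 2) (i + j)"
proof (induction i arbitrary: j n)
  case 0
  have "(\<Sum>l<Suc n. moment_coeff q 0 l * tridiag_apply q (moment_coeff q j) l)
      = (\<Sum>l<Suc n. if l = 0 then tridiag_apply q (moment_coeff q j) 0 else 0)"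
    by (rule sum.cong) (auto simp: moment_coeff_def)
  also have "\<dots> = moment_coeff q j 0 + moment_coeff q j 1"
    by (simp add: tridiag_apply_def)
  also have "\<dots> = binom_geom q (2 * j + 2) j"
    by (cases j) (simp_all add: moment_coeff_def binom_geom_pascal)
  finally show ?case by simp
next
  case (Suc i)
  then obtain m where n: "n = Suc m" and "i \<le> m"
    by (cases n) auto
  have "moment_coeff q i (Suc m) = 0" "moment_coeff q i (Suc (Suc m)) = 0"
    using \<open>i \<le> m\<close> by (simp_all add: moment_coeff_def)
  then have "(\<Sum>l<Suc n. moment_coeff q (Suc i) l * tridiag_apply q (moment_coeff q j) l)
      = (\<Sum>l<Suc n. moment_coeff q i l * tridiag_apply q (moment_coeff q (Suc j)) l)"
    by (simp only: n moment_coeff_Suc sum_mult_row mult_col_tridiag_apply) simp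
  also have "\<dots> = binom_geom q (2 * (i + Suc j) + 2) (i + Suc j)"
    using Suc.IH[of n "Suc j"] Suc.prems by simp
  finally show ?case by simp
qed

lemma hankel_factorization:
  fixes q :: "'a::comm_ring_1"
  defines "K n \<equiv> mat (Suc n) (Suc n) (\<lambda>(i, l). moment_coeff q i l)"
  shows "mat (Suc n) (Suc n) (\<lambda>(i, j). binom_geom q (2 * (i + j) + 2) (i + j))
    = K n * (mat (Suc n) (Suc n) (\<lambda>(i, j). tridiag q i j) * transpose_mat (K n))"
proof (rule eq_matI)
  fix i j
  assume "i < dim_row (K n * (mat (Suc n) (Suc n) (\<lambda>(i, j). tridiag q i j) * transpose_mat (K n)))"
    and "j < dim_col (K n * (mat (Suc n) (Suc n) (\<lambda>(i, j). tridiag q i j) * transpose_mat (K n)))"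
  then have ij: "i < Suc n" "j < Suc n" by (simp_all add: K_def)
  have TK: "(\<Sum>m<Suc n. tridiag q l m * moment_coeff q j m)
      = tridiag_apply q (moment_coeff q j) l" if "l < Suc n" for l
    using sum_tridiag[of l n q "moment_coeff q j"] that ij by (simp add: moment_coeff_def)
  have "(K n * (mat (Suc n) (Suc n) (\<lambda>(i, j). tridiag q i j) * transpose_mat (K n))) $$ (i, j)
      = (\<Sum>l<Suc n. moment_coeff q i l * (\<Sum>m<Suc n. tridiag q l m * moment_coeff q j m))"
    using ij by (simp add: K_def scalar_prod_def atLeast0LessThan del: sum.lessThan_Suc)
  also have "\<dots> = (\<Sum>l<Suc n. moment_coeff q i l * tridiag_apply q (moment_coeff q j) l)"
    by (rule sum.cong) (use TK in auto)
  also have "\<dots> = binom_geom q (2 * (i + j) + 2) (i + j)"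
    using ij by (intro moment_coeff_product) simp
  finally show "mat (Suc n) (Suc n) (\<lambda>(i, j). binom_geom q (2 * (i + j) + 2) (i + j)) $$ (i, j)
      = (K n * (mat (Suc n) (Suc n) (\<lambda>(i, j). tridiag q i j) * transpose_mat (K n))) $$ (i, j)"
    using ij by simp
qed (simp_all add: K_def)

section \<open>The determinant as a Chebyshev-like polynomial\<close>

text \<open>
  The solution \<open>V\<close> of the Chebyshev recurrence that starts with \<open>1, -1\<close>.  These initial values make
  the first row of \<open>T\<close> annihilate it as well.
\<close>

fun chebyshev :: "'a::comm_ring_1 \<Rightarrow> nat \<Rightarrow> 'a" where
  "chebyshev q 0 = 1"
| "chebyshev q (Suc 0) = - 1"
| "chebyshev q (Suc (Suc n)) = 2 * q * chebyshev q (Suc n) - chebyshev q n"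

lemma tridiag_apply_chebyshev: "tridiag_apply q (chebyshev q) = (\<lambda>_. 0)"
proof
  fix l
  show "tridiag_apply q (chebyshev q) l = 0"
    by (cases l) (simp_all add: tridiag_apply_def)
qed

lemma det_lower_unitriangular:
  fixes A :: "'a::comm_ring_1 mat"
  assumes A: "A \<in> carrier_mat n n"
    and upper: "\<And>i j. i < j \<Longrightarrow> j < n \<Longrightarrow> A $$ (i, j) = 0"
    and diag: "\<And>i. i < n \<Longrightarrow> A $$ (i, i) = 1"
  shows "det A = 1"
proof -
  have "diag_mat A = map (\<lambda>_. 1) [0..<n]"
    unfolding diag_mat_def using A diag by auto
  then show ?thesis
    using det_lower_triangular[OF upper A] by (simp add: map_replicate_const)
qed

text \<open>
  The sequence \<open>chebyshev q\<close> is annihilated by the infinite matrix, so replacing the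
  first column of the truncation by the product with this sequence (which starts with
  \<open>1\<close>) preserves the determinant and leaves a single nonzero entry in that column.
\<close>

lemma det_tridiag:
  fixes q :: "'a::comm_ring_1"
  shows "det (mat (Suc n) (Suc n) (\<lambda>(i, j). tridiag q i j)) = (- 1) ^ Suc n * chebyshev q (Suc n)"
proof -
  define T where "T = mat (Suc n) (Suc n) (\<lambda>(i, j). tridiag q i j)"
  define X where "X = mat (Suc n) (Suc n)
    (\<lambda>(i, j). if j = 0 then chebyshev q i else if i = j then 1 else 0)"
  have carrier: "T \<in> carrier_mat (Suc n) (Suc n)" "X \<in> carrier_mat (Suc n) (Suc n)"
    by (simp_all add: T_def X_def)
  have "det X = 1"
    by (rule det_lower_unitriangular[OF carrier(2)]) (auto simp: X_def)
  then have "det T = det (T * X)"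
    using det_mult[OF carrier] by simp
  have entry: "(T * X) $$ (i, j) = (\<Sum>l<Suc n. tridiag q i l * X $$ (l, j))"
    if "i < Suc n" "j < Suc n" for i j
    using that
    by (simp add: T_def X_def scalar_prod_def atLeast0LessThan del: sum.lessThan_Suc)
  have col0: "(T * X) $$ (i, 0) = (if i = n then - chebyshev q (Suc n) else 0)"
    if "i < Suc n" for i
  proof -
    have "(T * X) $$ (i, 0) = (\<Sum>l<Suc n. tridiag q i l * chebyshev q l)"
      unfolding entry[OF that zero_less_Suc] by (rule sum.cong) (auto simp: X_def)
    then show ?thesis
      using sum_tridiag[of i n q "chebyshev q"] that by (simp add: tridiag_apply_chebyshev)
  qed
  have col: "(T * X) $$ (i, Suc j) = tridiag q i (Suc j)"
    if "i < Suc n" "j < n" for i j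
  proof -
    have "(T * X) $$ (i, Suc j) = (\<Sum>l<Suc n. if l = Suc j then tridiag q i (Suc j) else 0)"
      unfolding entry[OF that(1) Suc_mono[OF that(2)]]
      by (rule sum.cong) (use that in \<open>auto simp: X_def\<close>)
    also have "\<dots> = tridiag q i (Suc j)"
      using that by (subst sum.delta) auto
    finally show ?thesis .
  qed
  have "det (mat_delete (T * X) n 0) = 1"
  proof (rule det_lower_unitriangular)
    show "mat_delete (T * X) n 0 \<in> carrier_mat n n"
      using mat_delete_carrier[of "T * X" "Suc n" "Suc n" n 0] carrier by simp
    have del: "mat_delete (T * X) n 0 $$ (i, j) = tridiag q i (Suc j)"
      if "i < n" "j < n" for i j
      using that carrier col[of i j] by (simp add: mat_delete_def T_def X_def)
    show "mat_delete (T * X) n 0 $$ (i, j) = 0" if "i < j" "j < n" for i j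
      using that del[of i j] by (simp add: tridiag_def)
    show "mat_delete (T * X) n 0 $$ (i, i) = 1" if "i < n" for i
      using that del[of i i] by (simp add: tridiag_def)
  qed
  then have cof: "cofactor (T * X) n 0 = (- 1) ^ n"
    by (simp add: cofactor_def)
  have "det (T * X) = (\<Sum>i<Suc n. (T * X) $$ (i, 0) * cofactor (T * X) i 0)"
    using laplace_expansion_column[of "T * X" "Suc n" 0] carrier by auto
  also have "\<dots> = (\<Sum>i<Suc n. if i = n then - chebyshev q (Suc n) * (- 1) ^ n else 0)"
    by (rule sum.cong) (use col0 cof in auto)
  also have "\<dots> = (- 1) ^ Suc n * chebyshev q (Suc n)"
    by (simp add: mult.commute)
  finally show ?thesis
    using \<open>det T = det (T * X)\<close> by (simp add: T_def)
qed

lemma hankel_det_eq_chebyshev: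
  "hankel_det n = (- 1) ^ Suc n * chebyshev ([:0, 1:] - 1) (Suc n)"
proof -
  define q :: "real poly" where "q = [:0, 1:] - 1"
  define K where "K = mat (Suc n) (Suc n) (\<lambda>(i, l). moment_coeff q i l)"
  define T where "T = mat (Suc n) (Suc n) (\<lambda>(i, j). tridiag q i j)"
  have carrier: "K \<in> carrier_mat (Suc n) (Suc n)" "T \<in> carrier_mat (Suc n) (Suc n)"
    "transpose_mat K \<in> carrier_mat (Suc n) (Suc n)"
    by (simp_all add: K_def T_def)
  have "det K = 1"
    by (rule det_lower_unitriangular[OF carrier(1)]) (auto simp: K_def moment_coeff_def)
  moreover have "hankel_det n = det (K * (T * transpose_mat K))"
    using hankel_factorization[of n q]
    by (simp add: hankel_det_def hankel_entry_eq_binom_geom K_def T_def q_def)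
  ultimately have "hankel_det n = det T"
    using carrier by (simp add: det_mult[of _ "Suc n"] det_transpose[of _ "Suc n"])
  then show ?thesis
    using det_tridiag[of n q] by (simp add: T_def q_def)
qed

section \<open>The differential equation\<close>

lemma pderiv_chebyshev_step:
  fixes q :: "real poly"
  assumes "pderiv q = 1" and "c = 2 * q * b - a"
  shows "pderiv c = 2 * q * pderiv b + 2 * b - pderiv a"
proof -
  have "c = q * b + q * b - a"
    using assms(2) by (simp add: algebra_simps)
  then have "pderiv c = pderiv (q * b) + pderiv (q * b) - pderiv a"
    by (simp only: pderiv_add pderiv_diff)
  then show ?thesis
    using assms(1) by (simp add: pderiv_mult algebra_simps)
qed

text \<open>
  The structure relation of the underlying Jacobi polynomials, expressing the derivative
  through a term and its successor or predecessor.  By the recurrence, the second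
  identity at \<open>n\<close> is the first at \<open>n + 1\<close>, and the two together give the second
  at \<open>n + 1\<close>.
\<close>

lemma chebyshev_pderiv:
  fixes q :: "real poly"
  assumes q: "pderiv q = 1"
  shows "2 * (q\<^sup>2 - 1) * pderiv (chebyshev q (Suc n))
      = - (2 * of_nat n * q + 2 * q + 1) * chebyshev q (Suc n)
        + (2 * of_nat n + 1) * chebyshev q (Suc (Suc n))
    \<and> 2 * (q\<^sup>2 - 1) * pderiv (chebyshev q (Suc (Suc n)))
      = (2 * of_nat n * q + 2 * q - 1) * chebyshev q (Suc (Suc n))
        - (2 * of_nat n + 3) * chebyshev q (Suc n)"
proof (induction n)
  case 0
  have "pderiv (2 * q) = 2"
    using q by (metis mult_2 one_add_one pderiv_add)
  then show ?case
    by (simp add: pderiv_diff pderiv_minus algebra_simps power2_eq_square)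
next
  case (Suc n)
  define a where "a = chebyshev q (Suc n)"
  define b where "b = chebyshev q (Suc (Suc n))"
  define c where "c = chebyshev q (Suc (Suc (Suc n)))"
  define N :: "real poly" where "N = of_nat n"
  have c: "c = 2 * q * b - a"
    by (simp add: a_def b_def c_def)
  have a': "2 * (q\<^sup>2 - 1) * pderiv a = - (2 * N * q + 2 * q + 1) * a + (2 * N + 1) * b"
    and b': "2 * (q\<^sup>2 - 1) * pderiv b = (2 * N * q + 2 * q - 1) * b - (2 * N + 3) * a"
    using Suc by (simp_all only: a_def b_def N_def)
  have c': "pderiv c = 2 * q * pderiv b + 2 * b - pderiv a"
    by (rule pderiv_chebyshev_step[OF q c])
  have "2 * (q\<^sup>2 - 1) * pderiv b = - (2 * (N + 1) * q + 2 * q + 1) * b + (2 * (N + 1) + 1) * c"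
    unfolding b' c by (simp add: algebra_simps)
  moreover have "2 * (q\<^sup>2 - 1) * pderiv c = (2 * (N + 1) * q + 2 * q - 1) * c - (2 * (N + 1) + 3) * b"
  proof -
    have "2 * (q\<^sup>2 - 1) * pderiv c = 2 * q * (2 * (q\<^sup>2 - 1) * pderiv b) + 4 * (q\<^sup>2 - 1) * b
        - 2 * (q\<^sup>2 - 1) * pderiv a"
      unfolding c' by (simp add: algebra_simps)
    also have "\<dots> = (2 * (N + 1) * q + 2 * q - 1) * c - (2 * (N + 1) + 3) * b"
      unfolding a' b' c by (simp add: algebra_simps power2_eq_square)
    finally show ?thesis .
  qed
  moreover have "of_nat (Suc n) = N + 1"
    by (simp add: N_def)
  ultimately show ?case
    by (simp only: b_def c_def)
qed

text \<open>
  In the variable \<open>q\<close>, where \<open>x (x - 2) = q\<^sup>2 - 1\<close> and \<open>2 x - 1 = 2 q + 1\<close>.  Applying the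
  differential operator to the recurrence expresses its value at the new term through its values at
  the two preceding terms, a multiple of the middle term, and \<open>q\<^sup>2 - 1\<close> times its derivative, which the
  structure relation eliminates.
\<close>

lemma chebyshev_ode:
  fixes q :: "real poly"
  assumes q: "pderiv q = 1"
  shows "(q\<^sup>2 - 1) * pderiv (pderiv (chebyshev q (Suc n))) + (2 * q + 1) * pderiv (chebyshev q (Suc n))
    = of_nat (n * (n + 1)) * chebyshev q (Suc n)"
proof (induction n rule: induct_nat_012)
  case 0
  show ?case by (simp add: pderiv_minus)
next
  case 1
  have "pderiv (chebyshev q (Suc (Suc 0))) = - 2"
    using pderiv_chebyshev_step[OF q, of "chebyshev q (Suc (Suc 0))" "- 1" 1]
    by (simp add: pderiv_minus)
  then show ?case
    by (simp add: pderiv_minus algebra_simps)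
next
  case (ge2 n)
  define a where "a = chebyshev q (Suc n)"
  define b where "b = chebyshev q (Suc (Suc n))"
  define c where "c = chebyshev q (Suc (Suc (Suc n)))"
  define N :: "real poly" where "N = of_nat n"
  have c: "c = 2 * q * b - a"
    by (simp add: a_def b_def c_def)
  have c': "pderiv c = 2 * q * pderiv b + 2 * b - pderiv a"
    by (rule pderiv_chebyshev_step[OF q c])
  then have "pderiv c = 2 * q * pderiv b - (pderiv a - (b + b))"
    by (simp add: algebra_simps)
  from pderiv_chebyshev_step[OF q this]
  have c'': "pderiv (pderiv c) = 2 * q * pderiv (pderiv b) + 4 * pderiv b - pderiv (pderiv a)"
    unfolding pderiv_diff pderiv_add by (simp add: algebra_simps)
  have a: "(q\<^sup>2 - 1) * pderiv (pderiv a) + (2 * q + 1) * pderiv a = N * (N + 1) * a"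
    and b: "(q\<^sup>2 - 1) * pderiv (pderiv b) + (2 * q + 1) * pderiv b = (N + 1) * (N + 2) * b"
    using ge2 by (simp_all add: a_def b_def N_def algebra_simps del: chebyshev.simps(3))
  have b': "2 * (q\<^sup>2 - 1) * pderiv b = (2 * N * q + 2 * q - 1) * b - (2 * N + 3) * a"
    using chebyshev_pderiv[OF q, of n] by (simp only: a_def b_def N_def)
  have "(q\<^sup>2 - 1) * pderiv (pderiv c) + (2 * q + 1) * pderiv c
      = 2 * q * ((q\<^sup>2 - 1) * pderiv (pderiv b) + (2 * q + 1) * pderiv b)
        + 2 * (2 * (q\<^sup>2 - 1) * pderiv b) + 2 * (2 * q + 1) * b
        - ((q\<^sup>2 - 1) * pderiv (pderiv a) + (2 * q + 1) * pderiv a)"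
    unfolding c'' unfolding c' by (simp add: algebra_simps)
  also have "\<dots> = (N + 2) * (N + 3) * c"
    unfolding a b b' c by (simp add: algebra_simps)
  finally have "(q\<^sup>2 - 1) * pderiv (pderiv c) + (2 * q + 1) * pderiv c = (N + 2) * (N + 3) * c" .
  moreover have "of_nat (Suc (Suc n) * (Suc (Suc n) + 1)) = (N + 2) * (N + 3)"
    by (simp add: N_def algebra_simps)
  ultimately show ?case
    by (simp only: c_def)
qed

theorem theorem4:
  fixes n :: nat and x y :: "real poly"
  defines "x \<equiv> [:0, 1:]"
  defines "y \<equiv> hankel_det n"
  shows "x * (x - 2) * pderiv (pderiv y) + (2 * x - 1) * pderiv y - of_nat (n * (n + 1)) * y = 0"
proof -
  define q :: "real poly" where "q = [:0, 1:] - 1"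
  have q: "pderiv q = 1"
    by (simp add: q_def pderiv_diff pderiv_pCons)
  have x: "x = q + 1"
    by (simp add: x_def q_def)
  have "y = smult ((- 1) ^ Suc n) (chebyshev q (Suc n))"
    by (simp only: y_def q_def hankel_det_eq_chebyshev) (cases "even n"; simp)
  then have "y = chebyshev q (Suc n) \<or> y = - chebyshev q (Suc n)"
    by (cases "even n") simp_all
  then have "(q\<^sup>2 - 1) * pderiv (pderiv y) + (2 * q + 1) * pderiv y = of_nat (n * (n + 1)) * y"
    using chebyshev_ode[OF q, of n] by (elim disjE) (simp_all only: pderiv_minus, algebra)
  then show ?thesis
    by (simp add: x algebra_simps power2_eq_square)
qed

end
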